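(* Assume that $b_i^u>0$ for all $i=0,1,\ldots$. For all $i\ge j\ge1$, $$c(i,j)=\begin{cases}-\gamma_1\left(\dfrac1{b_0^d}+\dfrac1{b_0^u}\right), & i=j=1,\\[2mm] \dfrac{1}{b_{i-1}^u}\left(-b_{i-1}^z c(0,j)-b_{i-1}^d c(i-2,j)+b_{i-1}^w c(i-1,j)+\delta_{i-1,j}\right), & \text{otherwise},\end{cases}$$ where $\gamma_1=c(0,1)/c(0,0)$ and $\delta_{i,j}$ equals $1$ if $i=j$ and $0$ otherwise.
   Context: Indices run over $0,1,2,\ldots$. Let $b_i^d,b_i^u$ ($i\ge 0$) and $b_i^z$ ($i\ge1$) be non-negative real numbers and let $b_i^w=b_i^z+b_i^d+b_i^u>0$ for $i\ge1$. The infinite matrix $B=(B(i,j))_{i,j\ge0}$ is defined by: $B(0,0)=-b_0^d-b_0^u$, $B(0,1)=b_0^u$; $B(1,0)=b_1^d+b_1^z$, $B(1,1)=-b_1^w$, $B(1,2)=b_1^u$; and for $i\ge2$: $B(i,0)=b_i^z$, $B(i,i-1)=b_i^d$, $B(i,i)=-b_i^w$, $B(i,i+1)=b_i^u$; all other entries are $0$. It is assumed that $b_i^d>0$ for all $i\ge0$. $C=(c(i,j))_{i,j\ge0}$ denotes the inverse of $B$, i.e. $C=B^{-1}$, so that $CB=BC=I$. Here $c(0,0)=-1/b_0^d\neq0$. *)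

theory Defs
  imports Complex_Main
begin

type_synonym inf_matrix = "nat \<Rightarrow> nat \<Rightarrow> real"

definition kronecker :: inf_matrix where
  "kronecker i j = (if i = j then 1 else 0)"

definition bw :: "(nat \<Rightarrow> real) \<Rightarrow> (nat \<Rightarrow> real) \<Rightarrow> (nat \<Rightarrow> real) \<Rightarrow> nat \<Rightarrow> real" where
  "bw bz bd bu i = bz i + bd i + bu i"

(* The value bz 0 is never used: bz is indexed from 1 on. *)
definition B_matrix ::
  "(nat \<Rightarrow> real) \<Rightarrow> (nat \<Rightarrow> real) \<Rightarrow> (nat \<Rightarrow> real) \<Rightarrow> inf_matrix" where
  "B_matrix bz bd bu i j =
     (if i = 0 then
        (if j = 0 then - bd 0 - bu 0
         else if j = 1 then bu 0
         else 0)
      else if i = 1 then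
        (if j = 0 then bd 1 + bz 1
         else if j = 1 then - bw bz bd bu 1
         else if j = 2 then bu 1
         else 0)
      else
        (if j = 0 then bz i
         else if j = i - 1 then bd i
         else if j = i then - bw bz bd bu i
         else if j = i + 1 then bu i
         else 0))"

(* The product of M and N exists and equals P. Entries of a product of infinite
   matrices are infinite series in the natural order of the index; plain
   (possibly conditional) convergence is all that is required. *)
definition is_matrix_product :: "inf_matrix \<Rightarrow> inf_matrix \<Rightarrow> inf_matrix \<Rightarrow> bool" where
  "is_matrix_product M N P \<longleftrightarrow> (\<forall>i j. (\<lambda>k. M i k * N k j) sums P i j)"

(* A two-sided inverse of an infinite matrix need not be unique. *)
definition is_inverse :: "inf_matrix \<Rightarrow> inf_matrix \<Rightarrow> bool" where
  "is_inverse C B \<longleftrightarrow> is_matrix_product C B kronecker \<and> is_matrix_product B C kronecker"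

definition gamma1 :: "inf_matrix \<Rightarrow> real" where
  "gamma1 c = c 0 1 / c 0 0"

end

theory Submission
  imports Defs
begin

text \<open>
  The recurrence is the identity \<open>BC = I\<close> read row by row: each row of \<open>B\<close> has at most four nonzero
  entries, so every series defining an entry of \<open>BC\<close> is a finite sum, and row \<open>i - 1\<close> of \<open>B\<close> can be
  solved for \<open>c(i,j)\<close> because its last entry \<open>b\<^sub>i\<^sub>-\<^sub>1\<^sup>u\<close> is nonzero. Row \<open>0\<close> expresses \<open>c(1,1)\<close> through
  \<open>c(0,1)\<close>, and \<open>c(0,1) = - \<gamma>\<^sub>1 / b\<^sub>0\<^sup>d\<close> by the value of \<open>c(0,0)\<close>; the rows \<open>i - 1 \<ge> 1\<close> give the
  general case.
\<close>

lemma B_matrix_row_0_sums: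
  "(\<lambda>k. B_matrix bz bd bu 0 k * v k) sums (- (bd 0 + bu 0) * v 0 + bu 0 * v 1)"
proof -
  have "(\<lambda>k. (if k = 0 then - (bd 0 + bu 0) * v k else 0) + (if k = 1 then bu 0 * v k else 0))
      sums (- (bd 0 + bu 0) * v 0 + bu 0 * v 1)"
    by (intro sums_add sums_single)
  also have "(\<lambda>k. (if k = 0 then - (bd 0 + bu 0) * v k else 0) + (if k = 1 then bu 0 * v k else 0))
      = (\<lambda>k. B_matrix bz bd bu 0 k * v k)"
    by (auto simp: B_matrix_def fun_eq_iff)
  finally show ?thesis .
qed

text \<open>
  Writing a row as a sum of point contributions also covers row \<open>1\<close>, where the columns \<open>0\<close> and
  \<open>i - 1\<close> coincide and the two contributions add up to the entry \<open>b\<^sub>1\<^sup>d + b\<^sub>1\<^sup>z\<close>.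
\<close>

lemma B_matrix_row_pos_sums:
  assumes "i \<ge> 1"
  shows "(\<lambda>k. B_matrix bz bd bu i k * v k) sums
    (bz i * v 0 + bd i * v (i - 1) - bw bz bd bu i * v i + bu i * v (i + 1))"
proof -
  have "(\<lambda>k. (if k = 0 then bz i * v k else 0) + (if k = i - 1 then bd i * v k else 0)
        - (if k = i then bw bz bd bu i * v k else 0) + (if k = i + 1 then bu i * v k else 0))
      sums (bz i * v 0 + bd i * v (i - 1) - bw bz bd bu i * v i + bu i * v (i + 1))"
    by (intro sums_add sums_diff sums_single)
  also have "(\<lambda>k. (if k = 0 then bz i * v k else 0) + (if k = i - 1 then bd i * v k else 0)
        - (if k = i then bw bz bd bu i * v k else 0) + (if k = i + 1 then bu i * v k else 0))
      = (\<lambda>k. B_matrix bz bd bu i k * v k)"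
    using assms by (auto simp: B_matrix_def fun_eq_iff algebra_simps)
  finally show ?thesis .
qed

theorem proposition4:
  fixes bz bd bu :: "nat \<Rightarrow> real" and c :: inf_matrix
  assumes bz_nonneg: "\<And>i. i \<ge> 1 \<Longrightarrow> bz i \<ge> 0"
    and bd_nonneg: "\<And>i. bd i \<ge> 0"
    and bu_nonneg: "\<And>i. bu i \<ge> 0"
    and bw_pos: "\<And>i. i \<ge> 1 \<Longrightarrow> bw bz bd bu i > 0"
    and bd_pos: "\<And>i. bd i > 0"
    and inverse: "is_inverse c (B_matrix bz bd bu)"
    and c00: "c 0 0 = - 1 / bd 0"
    and bu_pos: "\<And>i. bu i > 0"
  shows "\<forall>i j. i \<ge> j \<and> j \<ge> 1 \<longrightarrow>
    c i j =
      (if i = 1 \<and> j = 1 then - gamma1 c * (1 / bd 0 + 1 / bu 0)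
       else 1 / bu (i - 1) *
         (- bz (i - 1) * c 0 j - bd (i - 1) * c (i - 2) j
          + bw bz bd bu (i - 1) * c (i - 1) j + kronecker (i - 1) j))"
proof (intro allI impI)
  fix i j :: nat
  assume ij: "i \<ge> j \<and> j \<ge> 1"
  have BC: "(\<lambda>k. B_matrix bz bd bu m k * c k j) sums kronecker m j" for m
    using inverse by (simp add: is_inverse_def is_matrix_product_def)
  have bd0: "bd 0 \<noteq> 0" and bu0: "bu m \<noteq> 0" for m
    using bd_pos[of 0] bu_pos[of m] by auto
  show "c i j =
      (if i = 1 \<and> j = 1 then - gamma1 c * (1 / bd 0 + 1 / bu 0)
       else 1 / bu (i - 1) *
         (- bz (i - 1) * c 0 j - bd (i - 1) * c (i - 2) j
          + bw bz bd bu (i - 1) * c (i - 1) j + kronecker (i - 1) j))"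
  proof (cases "i = 1")
    case True
    then have j: "j = 1"
      using ij by simp
    have "- (bd 0 + bu 0) * c 0 1 + bu 0 * c 1 1 = 0"
      using sums_unique2[OF B_matrix_row_0_sums BC[of 0]] j by (simp add: kronecker_def)
    then have "c 1 1 = (bd 0 + bu 0) * c 0 1 / bu 0"
      using bu0[of 0] by (simp add: field_simps)
    also have "\<dots> = - gamma1 c * (1 / bd 0 + 1 / bu 0)"
      using bd0 bu0[of 0] by (simp add: gamma1_def c00 field_simps)
    finally show ?thesis
      using True j by simp
  next
    case False
    define m where "m = i - 1"
    have m: "m \<ge> 1" "i = m + 1" "i - 1 = m" "i - 2 = m - 1"
      using False ij by (auto simp: m_def)
    have "bz m * c 0 j + bd m * c (m - 1) j - bw bz bd bu m * c m j + bu m * c (m + 1) j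
        = kronecker m j"
      by (rule sums_unique2[OF B_matrix_row_pos_sums[OF m(1)] BC])
    then have "bu m * c i j = - bz m * c 0 j - bd m * c (m - 1) j + bw bz bd bu m * c m j
        + kronecker m j"
      unfolding m(2) by simp
    then have "c i j = 1 / bu m * (- bz m * c 0 j - bd m * c (m - 1) j + bw bz bd bu m * c m j
        + kronecker m j)"
      using bu0[of m] by (simp add: nonzero_eq_divide_eq mult.commute)
    then show ?thesis
      using False unfolding m(3,4) by simp
  qed
qed

end
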